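(* Let $\lambda>0$, let $K\subset\mathbb{R}^n$ be a non-empty closed set, and let $$V_{\lambda,K}=\{x\in\mathbb{R}^n:\ \lambda\,\mathrm{dist}(x;M_K)\leq\mathrm{dist}(x;K)\}.$$ Then $\mathrm{dist}^2(\cdot;K)\in C^{1,1}(\mathbb{R}^n\setminus V_{\lambda,K})$. Furthermore, for all $y,z\in\mathbb{R}^n\setminus V_{\lambda,K}$ with $y\neq z$, $$\frac{|D\,\mathrm{dist}^2(y;K)-D\,\mathrm{dist}^2(z;K)|}{|y-z|}\leq 2\max\{1,\lambda\}.$$
   Context: $|\cdot|$ is the Euclidean norm on $\mathbb{R}^n$ and $\mathrm{dist}(x;E)=\inf\{|x-y|: y\in E\}$, with the convention $\mathrm{dist}(x;\varnothing)=+\infty$ (so $V_{\lambda,K}=\varnothing$ if $M_K=\varnothing$). For a non-empty closed set $K\subset\mathbb{R}^n$, the medial axis $M_K$ is the set of points $x\in\mathbb{R}^n\setminus K$ for which there are at least two different points $y_1,y_2\in K$ with $\mathrm{dist}(x;K)=|x-y_1|=|x-y_2|$. The set $V_{\lambda,K}$ is closed. $D f$ denotes the gradient of $f$, and $f\in C^{1,1}(U)$ for $U$ open means $f$ is differentiable on $U$ with Lipschitz continuous gradient on $U$. *)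

theory Defs
  imports "HOL-Analysis.Analysis"
begin

(* The library's infdist x {} is 0; here the distance to the empty set is +\<infinity>,
   the infimum of the empty set in ereal. *)
definition edist_set :: "'a::metric_space \<Rightarrow> 'a set \<Rightarrow> ereal" where
  "edist_set x E = (INF y\<in>E. ereal (dist x y))"

lemma edist_set_empty: "edist_set x {} = \<infinity>"
  by (simp add: edist_set_def top_ereal_def)

lemma edist_set_eq_infdist:
  assumes "E \<noteq> {}"
  shows "edist_set x E = ereal (infdist x E)"
proof (rule antisym)
  show "ereal (infdist x E) \<le> edist_set x E"
    unfolding edist_set_def by (rule INF_greatest) (simp add: infdist_le)
  show "edist_set x E \<le> ereal (infdist x E)"
  proof (rule ereal_le_epsilon2)
    fix e :: real assume "0 < e"
    then have "(INF y\<in>E. dist x y) < infdist x E + e"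
      using assms by (simp add: infdist_notempty)
    then obtain y where y: "y \<in> E" "dist x y < infdist x E + e"
      using assms by (subst (asm) cINF_less_iff) auto
    have "edist_set x E \<le> ereal (dist x y)"
      unfolding edist_set_def using y(1) by (rule INF_lower)
    also have "\<dots> \<le> ereal (infdist x E) + ereal e" using y(2) by simp
    finally show "edist_set x E \<le> ereal (infdist x E) + ereal e" .
  qed
qed

definition medial_axis :: "'a::metric_space set \<Rightarrow> 'a set" where
  "medial_axis K =
     {x. x \<notin> K \<and> (\<exists>y1\<in>K. \<exists>y2\<in>K. y1 \<noteq> y2 \<and> infdist x K = dist x y1 \<and> infdist x K = dist x y2)}"

definition V_set :: "real \<Rightarrow> 'a::metric_space set \<Rightarrow> 'a set" where
  "V_set l K = {x. ereal l * edist_set x (medial_axis K) \<le> edist_set x K}"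

(* Meaningful only where f is differentiable. *)
definition gradient :: "('a::real_inner \<Rightarrow> real) \<Rightarrow> 'a \<Rightarrow> 'a" where
  "gradient f x = (THE D. GDERIV f x :> D)"

lemma gradient_eqI:
  assumes "GDERIV f x :> D"
  shows "gradient f x = D"
  unfolding gradient_def
proof (rule the_equality[where P = "\<lambda>D. GDERIV f x :> D", OF assms])
  fix D' assume "GDERIV f x :> D'"
  then have "(\<lambda>h. h \<bullet> D') = (\<lambda>h. h \<bullet> D)"
    using assms unfolding gderiv_def by (rule has_derivative_unique)
  then have "\<And>h. h \<bullet> D' = h \<bullet> D" by meson
  then show "D' = D" by (metis vector_eq_ldot)
qed

(* Intended for open U; differentiability is required at the unrestricted filter. *)
definition C11_on :: "('a::real_inner \<Rightarrow> real) \<Rightarrow> 'a set \<Rightarrow> bool" where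
  "C11_on f U \<longleftrightarrow>
     (\<forall>x\<in>U. f differentiable (at x)) \<and> (\<exists>L. L-lipschitz_on U (gradient f))"

end

theory Submission
  imports Defs
begin

text \<open>
  Write \<open>p\<close> for a nearest point of \<open>K\<close> to \<open>x\<close> and \<open>q = x - p\<close>. If \<open>x\<close> lies outside \<open>V_set l K\<close>, the ball
  about \<open>x\<close> of radius \<open>r = norm q / l\<close> misses the medial axis, so the nearest-point map \<open>P\<close> is
  continuous there. A Brouwer fixed point of \<open>y \<mapsto> x + r (x - P y) / norm (x - P y)\<close>
  shows that \<open>p\<close> is still a nearest point of \<open>x + q / l\<close>. Hence \<open>K\<close> avoids the open ball about
  \<open>x + q / l\<close> through \<open>p\<close>, which is equivalent to the global lower bound
  \<open>dist\<^sup>2 z \<ge> dist\<^sup>2 x + 2 q \<bullet> (z - x) - l \<bar>z - x\<bar>\<^sup>2\<close>; the upper bound with coefficient \<open>1\<close> is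
  trivial. Such two-sided bounds, valid for all \<open>z\<close>, give the gradient \<open>2 q\<close> and its
  Lipschitz constant even though the complement of \<open>V_set l K\<close> need not be convex.
\<close>

section \<open>Gradients from two-sided quadratic bounds\<close>

lemma GDERIV_of_quadratic_bound:
  fixes g :: "'a::real_inner \<Rightarrow> real"
  assumes "\<And>z. \<bar>g z - g x - a \<bullet> (z - x)\<bar> \<le> L * (norm (z - x))\<^sup>2"
  shows "GDERIV g x :> a"
  unfolding gderiv_def
proof (rule has_derivativeI_sandwich[where e = 1 and H = "\<lambda>z. L * norm (z - x)"])
  show "bounded_linear (\<lambda>h. h \<bullet> a)"
    by (rule bounded_linear_inner_left)
  show "norm (g z - g x - (z - x) \<bullet> a) / norm (z - x) \<le> L * norm (z - x)" if "z \<noteq> x" for z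
    using assms[of z] that by (simp add: inner_commute divide_simps power2_eq_square mult.assoc)
  show "((\<lambda>z. L * norm (z - x)) \<longlongrightarrow> 0) (at x)"
    by (auto intro!: tendsto_eq_intros)
qed simp

text \<open>The bounds hold at every \<open>z\<close>, so the test points need not lie on the
  segment from \<open>x\<close> to \<open>y\<close>: they are its midpoint shifted by
  \<open>h\<close> and by \<open>- h\<close>, and the parallelogram law evaluates the total
  error.\<close>

lemma quadratic_bounds_imp_lipschitz:
  fixes g :: "'a::real_inner \<Rightarrow> real"
  assumes x: "\<And>z. \<bar>g z - g x - a \<bullet> (z - x)\<bar> \<le> L * (norm (z - x))\<^sup>2"
    and y: "\<And>z. \<bar>g z - g y - b \<bullet> (z - y)\<bar> \<le> L * (norm (z - y))\<^sup>2"
    and "x \<noteq> y"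
  shows "norm (a - b) \<le> 2 * L * norm (x - y)"
proof (cases "a = b")
  case True
  have "0 \<le> L * (norm (y - x))\<^sup>2"
    using x[of y] by linarith
  with \<open>x \<noteq> y\<close> have "0 \<le> L"
    by (simp add: zero_le_mult_iff)
  with True show ?thesis by simp
next
  case False
  define e where "e = (1/2) *\<^sub>R (x - y)"
  define m where "m = (1/2) *\<^sub>R (x + y)"
  \<comment> \<open>This direction maximises \<open>(a - b) \<bullet> h\<close> for a given length;
    the length \<open>norm e\<close> minimises the ratio of the error
    \<open>2 * L * ((norm h)\<^sup>2 + (norm e)\<^sup>2)\<close> to \<open>norm h\<close>.\<close>
  define h where "h = (norm e / norm (a - b)) *\<^sub>R (a - b)"
  have xy: "x = m + e" "y = m - e"
    by (simp_all add: e_def m_def algebra_simps flip: scaleR_left_distrib)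
  have e: "e \<noteq> 0" using \<open>x \<noteq> y\<close> by (simp add: e_def)
  have h: "norm h = norm e" using False by (simp add: h_def)
  have para: "(norm (h - e))\<^sup>2 + (norm (h + e))\<^sup>2 = 4 * (norm e)\<^sup>2"
    using h by (simp add: power2_norm_eq_inner algebra_simps inner_commute norm_eq)
  have "(a - b) \<bullet> h \<le> L * ((norm (h - e))\<^sup>2 + (norm (h + e))\<^sup>2)"
  proof -
    \<comment> \<open>compare the lower bound at one point with the upper bound at the other, at \<open>m + h\<close> and
      then, with the roles exchanged, at \<open>m - h\<close>\<close>
    have 1: "norm (- e - h) = norm (e + h)" "norm (e - h) = norm (h - e)"
      by (metis minus_add_distrib norm_minus_cancel diff_conv_add_uminus)
        (rule norm_minus_commute)
    show ?thesis
      using x[of "m + h"] y[of "m + h"] x[of "m - h"] y[of "m - h"] 1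
      by (simp add: xy algebra_simps abs_le_iff)
  qed
  moreover have "(a - b) \<bullet> h = norm (a - b) * norm e"
    using False by (simp add: h_def dot_square_norm power2_eq_square)
  ultimately have "norm (a - b) * norm e \<le> (4 * L * norm e) * norm e"
    unfolding para by (simp add: power2_eq_square mult.assoc mult.left_commute)
  then have "norm (a - b) \<le> 4 * L * norm e"
    using e by (simp add: mult_le_cancel_right)
  then show ?thesis by (simp add: e_def)
qed

section \<open>Nearest points off the medial axis\<close>

lemma infdist_closest_point:
  fixes K :: "'a::{real_inner,heine_borel} set"
  assumes "closed K" "K \<noteq> {}"
  shows "infdist x K = dist x (closest_point K x)"
  using assms closest_point_in_set[OF assms] closest_point_le[OF assms(1)]
  by (intro antisym infdist_le) (auto simp: infdist_notempty intro!: cINF_greatest)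

lemma nearest_point_unique:
  assumes "closed K" "x \<notin> medial_axis K"
    and "a \<in> K" "dist x a = infdist x K" and "b \<in> K" "dist x b = infdist x K"
  shows "a = b"
proof (cases "x \<in> K")
  case True
  with assms show ?thesis by simp
next
  case False
  with assms show ?thesis unfolding medial_axis_def by (metis (mono_tags, lifting) mem_Collect_eq)
qed

text \<open>Uniqueness of nearest points turns the graph into a closed condition, and a closed graph
  with values in a compact ball forces continuity.\<close>

lemma continuous_on_closest_point_off_medial_axis:
  fixes K :: "'a::euclidean_space set"
  assumes K: "closed K" "K \<noteq> {}" and "compact S" "S \<inter> medial_axis K = {}"
  shows "continuous_on S (closest_point K)"
proof -
  have "bounded ((\<lambda>y. infdist y K) ` S)"
    by (intro compact_imp_bounded compact_continuous_image continuous_intros \<open>compact S\<close>)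
  then obtain B where B: "\<And>y. y \<in> S \<Longrightarrow> infdist y K \<le> B"
    by (auto simp: bounded_real) (meson abs_le_D1)
  obtain C where C: "\<And>y. y \<in> S \<Longrightarrow> norm y \<le> C"
    using compact_imp_bounded[OF \<open>compact S\<close>] by (auto simp: bounded_iff)
  have fim: "closest_point K \<in> S \<rightarrow> cball 0 (C + B)"
  proof
    fix y assume "y \<in> S"
    have "norm (closest_point K y) \<le> norm y + dist y (closest_point K y)"
      by (metis dist_norm norm_triangle_sub norm_minus_commute)
    with B[OF \<open>y \<in> S\<close>] C[OF \<open>y \<in> S\<close>] show "closest_point K y \<in> cball 0 (C + B)"
      by (simp add: infdist_closest_point[OF K])
  qed
  have "(\<lambda>y. (y, closest_point K y)) ` S =
      S \<times> K \<inter> {u. dist (fst u) (snd u) = infdist (fst u) K}"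
  proof -
    have "b = closest_point K y" if "y \<in> S" "b \<in> K" "dist y b = infdist y K" for y b
      using that \<open>S \<inter> medial_axis K = {}\<close>
      by (intro nearest_point_unique[OF K(1)] closest_point_in_set[OF K])
        (auto simp: infdist_closest_point[OF K])
    then show ?thesis
      by (auto simp: image_iff closest_point_in_set[OF K] infdist_closest_point[OF K])
  qed
  moreover have "closed (S \<times> K \<inter> {u. dist (fst u) (snd u) = infdist (fst u) K})"
    using \<open>compact S\<close> K
    by (intro closed_Int closed_Times closed_Collect_eq continuous_intros)
      (auto simp: compact_imp_closed)
  ultimately show ?thesis
    using fim by (intro continuous_from_closed_graph[OF compact_cball]) auto
qed

lemma closest_point_extends_along_normal:
  fixes K :: "'a::euclidean_space set"
  assumes K: "closed K" "K \<noteq> {}" and "x \<notin> K" "0 < r"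
    and r: "cball x r \<inter> medial_axis K = {}"
  defines "p \<equiv> closest_point K x"
  defines "c \<equiv> x + (r / norm (x - p)) *\<^sub>R (x - p)"
  shows "dist c p = infdist c K"
proof -
  define f where "f y = x + (r / norm (x - closest_point K y)) *\<^sub>R (x - closest_point K y)" for y
  note cp = closest_point_in_set[OF K]
  have ne: "x \<noteq> closest_point K y" for y
    using cp[of y] \<open>x \<notin> K\<close> by metis
  have "continuous_on (cball x r) f"
    unfolding f_def
    by (intro continuous_intros continuous_on_closest_point_off_medial_axis[OF K _ r]) (use ne in auto)
  moreover have "f \<in> cball x r \<rightarrow> cball x r"
    using \<open>0 < r\<close> ne by (auto simp: f_def dist_norm)
  \<comment> \<open>At a fixed point, \<open>x\<close> lies on the segment from \<open>y\<close> to
    the nearest point of \<open>y\<close>.\<close>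
  ultimately obtain y where y: "f y = y"
    using brouwer_ball[OF \<open>0 < r\<close>] by metis
  let ?t = "closest_point K y"
  define s where "s = r / norm (x - ?t)"
  have s: "0 < s" using \<open>0 < r\<close> ne[of y] by (simp add: s_def)
  have yx: "y - x = s *\<^sub>R (x - ?t)"
    using y by (simp add: f_def s_def algebra_simps)
  have "y - ?t = (y - x) + (x - ?t)"
    by simp
  also have "\<dots> = (1 + s) *\<^sub>R (x - ?t)"
    unfolding yx by (simp add: scaleR_left_distrib)
  finally have collinear: "dist y ?t = dist y x + dist x ?t"
    using s by (simp add: dist_norm yx distrib_right)
  \<comment> \<open>The term \<open>dist y x\<close> cancels in \<open>dist y x + dist x ?t = dist y
    ?t \<le> dist y p \<le> dist y x + dist x p\<close>.\<close>
  have "dist x ?t \<le> infdist x K"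
    using closest_point_le[OF K(1) cp, of y x] dist_triangle[of y p x] collinear
    unfolding p_def by (simp add: infdist_closest_point[OF K])
  then have "dist x ?t = infdist x K"
    using infdist_le[OF cp[of y], of x] by simp
  moreover have "x \<notin> medial_axis K"
    using r \<open>0 < r\<close> by (auto simp: disjoint_iff)
  ultimately have "?t = p"
    unfolding p_def
    using nearest_point_unique[OF K(1)] cp infdist_closest_point[OF K] by metis
  with y have "y = c" by (simp add: f_def c_def)
  with \<open>?t = p\<close> show ?thesis
    by (simp add: infdist_closest_point[OF K])
qed

text \<open>The inequality defining \<open>V_set\<close> is not strict, so its failure is strict and
  even the closed ball misses the axis.\<close>

lemma medial_axis_far:
  assumes "0 < l" "K \<noteq> {}" "x \<notin> V_set l K"
  shows "cball x (infdist x K / l) \<inter> medial_axis K = {}"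
proof (rule ccontr)
  assume "\<not> ?thesis"
  then obtain m where m: "m \<in> medial_axis K" "dist x m \<le> infdist x K / l"
    by auto
  have "edist_set x (medial_axis K) \<le> ereal (dist x m)"
    unfolding edist_set_def using m(1) by (rule INF_lower)
  then have "ereal l * edist_set x (medial_axis K) \<le> ereal l * ereal (dist x m)"
    using \<open>0 < l\<close> by (intro ereal_mult_left_mono) auto
  also have "\<dots> \<le> edist_set x K"
    using m(2) \<open>0 < l\<close> by (simp add: edist_set_eq_infdist[OF \<open>K \<noteq> {}\<close>] field_simps)
  finally show False
    using \<open>x \<notin> V_set l K\<close> by (simp add: V_set_def)
qed

section \<open>Quadratic bounds for the squared distance\<close>

lemma infdist_squared_upper:
  fixes K :: "'a::{real_inner,heine_borel} set"
  assumes K: "closed K" "K \<noteq> {}"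
  shows "(infdist z K)\<^sup>2 \<le>
    (infdist x K)\<^sup>2 + 2 * ((x - closest_point K x) \<bullet> (z - x)) + (norm (z - x))\<^sup>2"
proof -
  have "(infdist z K)\<^sup>2 \<le> (norm (z - closest_point K x))\<^sup>2"
    using infdist_le[OF closest_point_in_set[OF K], of z x]
    by (intro power_mono infdist_nonneg) (simp add: dist_norm)
  also have "\<dots> = (infdist x K)\<^sup>2 + 2 * ((x - closest_point K x) \<bullet> (z - x)) + (norm (z - x))\<^sup>2"
    unfolding infdist_closest_point[OF K, of x] dist_norm power2_norm_eq_inner
    by (simp add: algebra_simps inner_commute)
  finally show ?thesis .
qed

lemma infdist_squared_lower:
  fixes K :: "'a::euclidean_space set"
  assumes l: "0 < l" and K: "closed K" "K \<noteq> {}" and x: "x \<notin> V_set l K"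
  shows "(infdist x K)\<^sup>2 + 2 * ((x - closest_point K x) \<bullet> (z - x)) - l * (norm (z - x))\<^sup>2
    \<le> (infdist z K)\<^sup>2"
proof (cases "x \<in> K")
  case True
  \<comment> \<open>On \<open>K\<close> the vector \<open>x - closest_point K x\<close> vanishes, so
    there is no normal to follow and the bound is trivial.\<close>
  have "- (l * (norm (z - x))\<^sup>2) \<le> 0"
    using l by simp
  also have "\<dots> \<le> (infdist z K)\<^sup>2"
    by simp
  finally show ?thesis
    using True by (simp add: closest_point_self)
next
  case False
  define p where "p = closest_point K x"
  define q where "q = x - p"
  define k where "k = closest_point K z"
  define w where "w = k - p"
  define v where "v = z - x"
  have d: "infdist x K = norm q"
    by (simp add: infdist_closest_point[OF K] p_def q_def dist_norm)
  have k: "k \<in> K" by (simp add: k_def closest_point_in_set[OF K])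
  have "q \<noteq> 0"
    using False closest_point_in_set[OF K, of x] by (auto simp: q_def p_def)
  \<comment> \<open>The radius \<open>infdist x K / l\<close> equals \<open>norm q / l\<close>, so
    the step along the normal is exactly \<open>(1 / l) *\<^sub>R q\<close>.\<close>
  then have "dist (x + (1 / l) *\<^sub>R q) p = infdist (x + (1 / l) *\<^sub>R q) K"
    using closest_point_extends_along_normal[OF K False, of "infdist x K / l"]
      medial_axis_far[OF l K(2) x] l d
    by (simp add: p_def[symmetric] q_def[symmetric])
  then have "dist (x + (1 / l) *\<^sub>R q) p \<le> dist (x + (1 / l) *\<^sub>R q) k"
    using infdist_le[OF k] by simp
  moreover have "x = p + q" "k = p + w"
    by (simp_all add: q_def w_def)
  ultimately have "norm (q + (1 / l) *\<^sub>R q) \<le> norm (q + (1 / l) *\<^sub>R q - w)"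
    by (simp add: dist_norm algebra_simps)
  then have "2 * (1 + 1 / l) * (q \<bullet> w) \<le> w \<bullet> w"
    by (simp add: norm_le algebra_simps inner_commute)
  then have "l * (2 * (1 + 1 / l) * (q \<bullet> w)) \<le> l * (w \<bullet> w)"
    using l by (intro mult_left_mono) auto
  also have "l * (2 * (1 + 1 / l) * (q \<bullet> w)) = 2 * (1 + l) * (q \<bullet> w)"
    using l by (simp add: field_simps)
  finally have ball: "2 * (1 + l) * (q \<bullet> w) \<le> l * (w \<bullet> w)" .
  \<comment> \<open>Completing the square in \<open>v\<close>: \<open>1 + l\<close> times the
    difference of the two sides of the goal leaves a square plus the slack in
    \<open>ball\<close>.\<close>
  have "0 \<le> (norm ((1 + l) *\<^sub>R v - w))\<^sup>2 + (l * (w \<bullet> w) - 2 * (1 + l) * (q \<bullet> w))"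
    using ball by simp
  also have "\<dots> = (1 + l) * ((norm (v + q - w))\<^sup>2 - ((norm q)\<^sup>2 + 2 * (q \<bullet> v) - l * (norm v)\<^sup>2))"
    unfolding power2_norm_eq_inner by (simp add: algebra_simps inner_commute)
  finally have "(norm q)\<^sup>2 + 2 * (q \<bullet> v) - l * (norm v)\<^sup>2 \<le> (norm (v + q - w))\<^sup>2"
    using l by (simp add: zero_le_mult_iff)
  moreover have "infdist z K = norm (v + q - w)"
    by (simp add: infdist_closest_point[OF K] dist_norm k_def v_def q_def w_def)
  ultimately show ?thesis
    using d by (simp add: q_def p_def v_def)
qed

text \<open>The coefficient \<open>1\<close> comes from the upper bound and \<open>l\<close> from
  the lower one.\<close>

lemma infdist_squared_quadratic_bound:
  fixes K :: "'a::euclidean_space set"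
  assumes "0 < l" "closed K" "K \<noteq> {}" "x \<notin> V_set l K"
  shows "\<bar>(infdist z K)\<^sup>2 - (infdist x K)\<^sup>2 - (2 *\<^sub>R (x - closest_point K x)) \<bullet> (z - x)\<bar>
    \<le> max 1 l * (norm (z - x))\<^sup>2"
proof -
  have "1 * (norm (z - x))\<^sup>2 \<le> max 1 l * (norm (z - x))\<^sup>2" "l * (norm (z - x))\<^sup>2 \<le> max 1 l * (norm (z - x))\<^sup>2"
    by (intro mult_right_mono; simp)+
  then show ?thesis
    using infdist_squared_upper[OF assms(2,3), of z x] infdist_squared_lower[OF assms, of z]
    by (simp add: abs_le_iff)
qed

theorem corollary3p8:
  fixes K :: "(real ^ 'n) set" and l :: real
  assumes "l > 0" and "closed K" and "K \<noteq> {}"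
  shows "C11_on (\<lambda>x. (infdist x K)\<^sup>2) (- V_set l K) \<and>
    (\<forall>y z. y \<notin> V_set l K \<longrightarrow> z \<notin> V_set l K \<longrightarrow> y \<noteq> z \<longrightarrow>
       norm (gradient (\<lambda>x. (infdist x K)\<^sup>2) y - gradient (\<lambda>x. (infdist x K)\<^sup>2) z) / norm (y - z)
         \<le> 2 * max 1 l)"
proof -
  let ?g = "\<lambda>x. (infdist x K)\<^sup>2"
  note bound = infdist_squared_quadratic_bound[OF assms]
  have deriv: "GDERIV ?g x :> 2 *\<^sub>R (x - closest_point K x)" if "x \<notin> V_set l K" for x
    using bound[OF that] by (rule GDERIV_of_quadratic_bound)
  have lip: "norm (gradient ?g y - gradient ?g z) \<le> 2 * max 1 l * norm (y - z)"
    if "y \<notin> V_set l K" "z \<notin> V_set l K" for y z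
  proof (cases "y = z")
    case False
    then show ?thesis
      unfolding gradient_eqI[OF deriv[OF that(1)]] gradient_eqI[OF deriv[OF that(2)]]
      using bound[OF that(1)] bound[OF that(2)] by (intro quadratic_bounds_imp_lipschitz)
  qed simp
  have "(2 * max 1 l)-lipschitz_on (- V_set l K) (gradient ?g)"
    using lip by (intro lipschitz_onI) (auto simp: dist_norm)
  moreover have "?g differentiable (at x)" if "x \<notin> V_set l K" for x
    using deriv[OF that] by (auto simp: gderiv_def differentiable_def)
  ultimately show ?thesis
    using lip by (auto simp: C11_on_def divide_le_eq)
qed

end
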